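(* Let $M\in L^2(\mathbb{T}^3)$ and $PV_e\in H^{-1}$, and define for $p\in\mathring{H}^1$ $$E(p)=\int_{\mathbb{T}^3}\left(\tfrac12|\nabla p|^2-\tfrac14\min(M-\partial_3p,0)^2\right)+\langle PV_e,p\rangle .$$ For any $p\in\mathring{H}^1$, $p$ is a global minimizer of $E$ over $\mathring{H}^1$ if and only if it is an $\mathring{H}^1$-weak solution of $$-\Delta p-\tfrac12\partial_3\big(\min(M-\partial_3p,0)\big)=-PV_e,$$ in the sense that $$\int_{\mathbb{T}^3}\nabla p\cdot\nabla\phi+\tfrac12\min(M-\partial_3p,0)\,(\partial_3\phi)=-\langle PV_e,\phi\rangle\quad\text{for every }\phi\in\mathring{H}^1 .$$
   Context: $\mathbb{T}^3=(\mathbb{R}/L\mathbb{Z})^3$ is the 3-torus (with some fixed period $L>0$). $\mathring{H}^1=\{u\in L^2(\mathbb{T}^3):\nabla u\in L^2,\ \int_{\mathbb{T}^3}u=0\}$, $H^{-1}=(\mathring{H}^1)^*$ is its dual, and $\langle\cdot,\cdot\rangle$ is the $H^{-1}\times\mathring{H}^1$ duality pairing. *)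

theory Defs
  imports "HOL-Analysis.Analysis"
begin

text \<open>
  Functions on the torus \<open>(\<real>/L\<int>)\<^sup>3\<close> are represented by functions on \<open>\<real>\<^sup>3\<close> that are \<open>L\<close>-periodic in
  every coordinate, and integrals over the torus are Lebesgue integrals over a fundamental cell.
  Members of the function spaces below are representatives, not classes modulo null sets.
\<close>

definition periodic :: "real \<Rightarrow> (real^3 \<Rightarrow> real) \<Rightarrow> bool" where
  "periodic L u \<longleftrightarrow> (\<forall>x i. u (x + axis i L) = u x)"

definition torus :: "real \<Rightarrow> (real^3) measure" where
  "torus L = lebesgue_on {x. \<forall>i. 0 \<le> x $ i \<and> x $ i < L}"

definition L2 :: "real \<Rightarrow> (real^3 \<Rightarrow> real) set" where
  "L2 L = {u. periodic L u \<and> u \<in> borel_measurable (torus L) \<and> integrable (torus L) (\<lambda>x. (u x)\<^sup>2)}"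

definition pderiv :: "3 \<Rightarrow> (real^3 \<Rightarrow> real) \<Rightarrow> real^3 \<Rightarrow> real" where
  "pderiv i f x = frechet_derivative f (at x) (axis i 1)"

primrec C_k :: "nat \<Rightarrow> (real^3 \<Rightarrow> real) \<Rightarrow> bool" where
  "C_k 0 f \<longleftrightarrow> continuous_on UNIV f"
| "C_k (Suc k) f \<longleftrightarrow> f differentiable_on UNIV \<and> (\<forall>i. C_k k (pderiv i f))"

definition test_functions :: "real \<Rightarrow> (real^3 \<Rightarrow> real) set" where
  "test_functions L = {f. periodic L f \<and> (\<forall>k. C_k k f)}"

definition has_weak_gradient :: "real \<Rightarrow> (real^3 \<Rightarrow> real) \<Rightarrow> (real^3 \<Rightarrow> real^3) \<Rightarrow> bool" where
  "has_weak_gradient L u g \<longleftrightarrow>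
     (\<forall>i. (\<lambda>x. g x $ i) \<in> L2 L) \<and>
     (\<forall>f \<in> test_functions L. \<forall>i.
        (LINT x|torus L. u x * pderiv i f x) = - (LINT x|torus L. g x $ i * f x))"

text \<open>
  The distributional gradient is determined only up to a null set, so a representative is chosen;
  the definition is meaningful when \<open>u\<close> has a square-integrable distributional gradient.
\<close>

definition weak_gradient :: "real \<Rightarrow> (real^3 \<Rightarrow> real) \<Rightarrow> real^3 \<Rightarrow> real^3" where
  "weak_gradient L u = (SOME g. has_weak_gradient L u g)"

definition H1 :: "real \<Rightarrow> (real^3 \<Rightarrow> real) set" where
  "H1 L = {u \<in> L2 L. (\<exists>g. has_weak_gradient L u g) \<and> (LINT x|torus L. u x) = 0}"

definition H1_norm :: "real \<Rightarrow> (real^3 \<Rightarrow> real) \<Rightarrow> real" where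
  "H1_norm L u = sqrt (LINT x|torus L. (u x)\<^sup>2 + (norm (weak_gradient L u x))\<^sup>2)"

text \<open>
  The dual of \<open>H1 L\<close>: the values of a functional outside \<open>H1 L\<close> are irrelevant, boundedness makes it
  respect equality almost everywhere, and the duality pairing is application.
\<close>

definition H_minus1 :: "real \<Rightarrow> ((real^3 \<Rightarrow> real) \<Rightarrow> real) set" where
  "H_minus1 L = {F.
     (\<forall>u \<in> H1 L. \<forall>v \<in> H1 L. F (\<lambda>x. u x + v x) = F u + F v) \<and>
     (\<forall>c. \<forall>u \<in> H1 L. F (\<lambda>x. c * u x) = c * F u) \<and>
     (\<exists>C. \<forall>u \<in> H1 L. \<bar>F u\<bar> \<le> C * H1_norm L u)}"

definition energy ::
  "real \<Rightarrow> (real^3 \<Rightarrow> real) \<Rightarrow> ((real^3 \<Rightarrow> real) \<Rightarrow> real) \<Rightarrow> (real^3 \<Rightarrow> real) \<Rightarrow> real" where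
  "energy L M PV p =
     (LINT x|torus L. 1/2 * (norm (weak_gradient L p x))\<^sup>2
        - 1/4 * (min (M x - weak_gradient L p x $ 3) 0)\<^sup>2) + PV p"

end

theory Submission
  imports Defs "HOL-Real_Asymp.Real_Asymp"
begin

text \<open>
  The energy is quadratic up to a term with a Lipschitz derivative, and it is convex because the
  concave part is the weaker one. Write
  \<open>e m v = |v|\<^sup>2/2 - (min (m - v\<^sub>3) 0)\<^sup>2/4\<close> for the density. The function
  \<open>s \<mapsto> (min s 0)\<^sup>2\<close> has second derivative between \<open>0\<close> and \<open>2\<close>, so subtracting a quarter of it
  removes at most half of the convexity of \<open>|v|\<^sup>2/2\<close>. Hence the first-order Taylor remainder of
  \<open>e m\<close> at \<open>v\<close> in direction \<open>t w\<close> lies between \<open>0\<close> and \<open>t\<^sup>2 |w|\<^sup>2/2\<close>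
  (\<open>energy_density_expansion\<close>). Integrating, with \<open>A \<phi>\<close> for the difference of the two sides of the
  weak equation tested with \<open>\<phi>\<close>,
  \<open>0 \<le> E (p + t \<phi>) - E p - t (A \<phi>) \<le> t\<^sup>2/2 \<integral> |\<nabla>\<phi>|\<^sup>2\<close> (\<open>energy_expansion\<close>).
  If \<open>A\<close> vanishes, the lower bound at \<open>t = 1\<close>, \<open>\<phi> = q - p\<close> says that \<open>p\<close> minimizes. If \<open>p\<close>
  minimizes, the upper bound gives \<open>0 \<le> t (A \<phi>) + O (t\<^sup>2)\<close> for \<open>t\<close> of either sign, so \<open>A \<phi> = 0\<close>.

  The integrated expansion needs \<open>\<nabla>(p + t \<phi>) = \<nabla>p + t \<nabla>\<phi>\<close> almost everywhere. Since
  \<open>weak_gradient\<close> selects an arbitrary weak gradient, this linearity amounts to uniqueness of weak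
  gradients up to null sets, that is, to the fundamental lemma of the calculus of variations on the
  torus (\<open>fundamental_lemma\<close>): an integrable function orthogonal to all smooth periodic functions
  vanishes almost everywhere. For its proof, explicit smooth periodic functions built from \<open>cos\<close> and
  \<open>exp\<close> converge boundedly to the indicator of a box, whence the function has integral zero over
  boxes, and then over all measurable sets.
\<close>

section \<open>Square-integrable functions\<close>

definition square_integrable :: "'a measure \<Rightarrow> ('a \<Rightarrow> real) \<Rightarrow> bool" where
  "square_integrable M u \<longleftrightarrow> u \<in> borel_measurable M \<and> integrable M (\<lambda>x. (u x)\<^sup>2)"

lemma square_integrable_measurable:
  "square_integrable M u \<Longrightarrow> u \<in> borel_measurable M"
  by (simp add: square_integrable_def)

lemma square_integrable_bound:
  assumes "square_integrable M u" and v: "v \<in> borel_measurable M"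
    and "\<And>x. x \<in> space M \<Longrightarrow> \<bar>v x\<bar> \<le> \<bar>u x\<bar>"
  shows "square_integrable M v"
  unfolding square_integrable_def
proof
  show "integrable M (\<lambda>x. (v x)\<^sup>2)"
  proof (rule Bochner_Integration.integrable_bound)
    show "integrable M (\<lambda>x. (u x)\<^sup>2)" using assms(1) by (simp add: square_integrable_def)
    show "(\<lambda>x. (v x)\<^sup>2) \<in> borel_measurable M" using v by measurable
    show "AE x in M. norm ((v x)\<^sup>2) \<le> norm ((u x)\<^sup>2)"
      using assms(3) by (intro AE_I2) (simp add: abs_le_square_iff)
  qed
qed (rule v)

lemma square_integrable_mult_integrable:
  assumes "square_integrable M u" "square_integrable M v"
  shows "integrable M (\<lambda>x. u x * v x)"
proof (rule Bochner_Integration.integrable_bound)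
  show "integrable M (\<lambda>x. (u x)\<^sup>2 + (v x)\<^sup>2)"
    using assms by (simp add: square_integrable_def)
  show "(\<lambda>x. u x * v x) \<in> borel_measurable M"
    using assms by (intro borel_measurable_times square_integrable_measurable)
  have "\<bar>a * b\<bar> \<le> \<bar>a\<^sup>2 + b\<^sup>2\<bar>" for a b :: real
  proof -
    have "0 \<le> (\<bar>a\<bar> - \<bar>b\<bar>)\<^sup>2" "0 \<le> \<bar>a\<bar> * \<bar>b\<bar>" by simp_all
    then show ?thesis unfolding power2_diff abs_mult power2_abs by linarith
  qed
  then show "AE x in M. norm (u x * v x) \<le> norm ((u x)\<^sup>2 + (v x)\<^sup>2)" by simp
qed

lemma square_integrable_add:
  assumes "square_integrable M u" "square_integrable M v"
  shows "square_integrable M (\<lambda>x. u x + v x)"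
  using assms square_integrable_mult_integrable[OF assms]
  by (auto simp: square_integrable_def power2_sum mult.assoc)

lemma square_integrable_scale:
  "square_integrable M u \<Longrightarrow> square_integrable M (\<lambda>x. c * u x)"
  by (auto simp: square_integrable_def power_mult_distrib)

lemma square_integrable_diff:
  assumes "square_integrable M u" "square_integrable M v"
  shows "square_integrable M (\<lambda>x. u x - v x)"
  using square_integrable_add[OF assms(1) square_integrable_scale[OF assms(2), of "-1"]] by simp

lemma square_integrable_min_0:
  assumes "square_integrable M u"
  shows "square_integrable M (\<lambda>x. min (u x) 0)"
  using assms by (rule square_integrable_bound) (use assms in \<open>auto simp: square_integrable_def\<close>)

section \<open>Integration over the torus\<close>

definition cell :: "real \<Rightarrow> (real^3) set" where
  "cell L = {x. \<forall>i. 0 \<le> x $ i \<and> x $ i < L}"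

lemma cell_subset_cbox: "cell L \<subseteq> cbox 0 (\<chi> i. L)"
  by (force simp: cell_def mem_box_cart intro: less_imp_le)

lemma cell_borel: "cell L \<in> sets borel"
proof -
  have "{x::real^3. 0 \<le> x $ i} \<inter> {x. x $ i < L} \<in> sets borel" for i
    by (intro sets.Int borel_closed borel_open closed_halfspace_component_ge_cart
        open_halfspace_component_lt_cart)
  then have "(\<Inter>i\<in>UNIV. {x::real^3. 0 \<le> x $ i} \<inter> {x. x $ i < L}) \<in> sets borel"
    by (intro sets.finite_INT) auto
  then show ?thesis
    by (rule back_subst[of "\<lambda>A. A \<in> sets borel"]) (auto simp: cell_def)
qed

lemma cell_lmeasurable: "cell L \<in> lmeasurable"
  using bounded_subset[OF bounded_cbox cell_subset_cbox] cell_borel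
  by (intro bounded_set_imp_lmeasurable) auto

lemma cell_lebesgue: "cell L \<in> sets lebesgue"
  using cell_lmeasurable by auto

lemma torus_eq: "torus L = lebesgue_on (cell L)"
  by (simp add: torus_def cell_def)

lemma space_torus: "space (torus L) = cell L"
  by (simp add: torus_eq)

lemma finite_measure_torus: "finite_measure (torus L)"
  unfolding torus_eq by (rule finite_measure_lebesgue_on) (rule cell_lmeasurable)

lemma AE_torus_iff: "(AE x in torus L. P x) \<longleftrightarrow> (AE x in lebesgue. x \<in> cell L \<longrightarrow> P x)"
  unfolding torus_eq using cell_lebesgue by (intro AE_restrict_space_iff) auto

lemma borel_imp_torus_measurable: "f \<in> borel_measurable borel \<Longrightarrow> f \<in> borel_measurable (torus L)"
  unfolding torus_eq by (intro measurable_restrict_space1) (auto intro: borel_measurable_if_I measurable_completion)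

lemma continuous_imp_torus_integrable:
  fixes f :: "real^3 \<Rightarrow> real"
  assumes "continuous_on UNIV f"
  shows "integrable (torus L) f"
proof -
  interpret finite_measure "torus L" by (rule finite_measure_torus)
  have "compact (f ` cbox 0 (\<chi> i. L))"
    by (intro compact_continuous_image continuous_on_subset[OF assms] compact_cbox) auto
  then obtain B where "\<And>x. x \<in> cbox 0 (\<chi> i. L) \<Longrightarrow> \<bar>f x\<bar> \<le> B"
    using compact_imp_bounded[of "f ` cbox 0 (\<chi> i. L)"] by (auto simp: bounded_iff)
  then have "AE x in torus L. norm (f x) \<le> B"
    using cell_subset_cbox by (intro AE_I2) (auto simp: space_torus)
  moreover have "f \<in> borel_measurable (torus L)"
    using assms by (intro borel_imp_torus_measurable borel_measurable_continuous_onI)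
  ultimately show ?thesis by (rule integrable_const_bound)
qed

lemma continuous_imp_square_integrable:
  fixes f :: "real^3 \<Rightarrow> real"
  assumes "continuous_on UNIV f"
  shows "square_integrable (torus L) f"
  unfolding square_integrable_def
  using assms borel_measurable_integrable[OF continuous_imp_torus_integrable[OF assms]]
  by (intro conjI continuous_imp_torus_integrable continuous_intros) auto

lemma square_integrable_torus_imp_integrable:
  assumes "square_integrable (torus L) u"
  shows "integrable (torus L) u"
  using square_integrable_mult_integrable[OF assms continuous_imp_square_integrable[of "\<lambda>x. 1"]]
  by simp

section \<open>Smooth periodic approximations of boxes\<close>

text \<open>
  A class of explicit functions closed under partial derivatives, so that smoothness of all orders
  is a plain induction. The cosine needs no rule of its own, being a shifted sine.
\<close>
inductive trig_exp :: "(real^3 \<Rightarrow> real) \<Rightarrow> bool" where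
  const: "trig_exp (\<lambda>x. c)"
| sin: "trig_exp (\<lambda>x. sin (w * x $ i + d))"
| add: "trig_exp f \<Longrightarrow> trig_exp g \<Longrightarrow> trig_exp (\<lambda>x. f x + g x)"
| mult: "trig_exp f \<Longrightarrow> trig_exp g \<Longrightarrow> trig_exp (\<lambda>x. f x * g x)"
| exp: "trig_exp f \<Longrightarrow> trig_exp (\<lambda>x. exp (f x))"

lemma trig_exp_sum:
  assumes "finite I" "\<And>i. i \<in> I \<Longrightarrow> trig_exp (f i)"
  shows "trig_exp (\<lambda>x. \<Sum>i\<in>I. f i x)"
  using assms by (induction I rule: finite_induct) (auto intro: trig_exp.intros)

lemma trig_exp_cos: "trig_exp (\<lambda>x. cos (w * x $ i + d))"
proof -
  have "cos (w * x $ i + d) = sin (w * x $ i + (d + pi/2))" for x :: "real^3"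
    by (simp add: sin_add cos_add)
  then show ?thesis using trig_exp.sin[of w i "d + pi/2"] by simp
qed

lemma trig_exp_has_derivative:
  assumes "trig_exp f"
  shows "\<exists>f'. (\<forall>x. (f has_derivative f' x) (at x)) \<and> (\<forall>i. trig_exp (\<lambda>x. f' x (axis i 1)))"
  using assms
proof induction
  case (const c)
  show ?case by (rule exI[of _ "\<lambda>_ _. 0"]) (auto intro: trig_exp.intros)
next
  case (sin w i d)
  have "((\<lambda>x. sin (w * x $ i + d)) has_derivative (\<lambda>h. cos (w * x $ i + d) * (w * h $ i))) (at x)" for x
    by (auto intro!: derivative_eq_intros bounded_linear.has_derivative[OF bounded_linear_vec_nth])
  moreover have "trig_exp (\<lambda>x. cos (w * x $ i + d) * (w * axis j 1 $ i))" for j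
    by (intro trig_exp.intros trig_exp_cos)
  ultimately show ?case
    by (intro exI[of _ "\<lambda>x h. cos (w * x $ i + d) * (w * h $ i)"]) blast
next
  case (add f g)
  then obtain f' g' where "\<And>x. (f has_derivative f' x) (at x)" "\<And>x. (g has_derivative g' x) (at x)"
    "\<And>i. trig_exp (\<lambda>x. f' x (axis i 1))" "\<And>i. trig_exp (\<lambda>x. g' x (axis i 1))" by blast
  then show ?case
    by (intro exI[of _ "\<lambda>x h. f' x h + g' x h"]) (auto intro!: derivative_intros trig_exp.intros)
next
  case (mult f g)
  then obtain f' g' where "\<And>x. (f has_derivative f' x) (at x)" "\<And>x. (g has_derivative g' x) (at x)"
    "\<And>i. trig_exp (\<lambda>x. f' x (axis i 1))" "\<And>i. trig_exp (\<lambda>x. g' x (axis i 1))" by blast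
  with mult.hyps show ?case
    by (intro exI[of _ "\<lambda>x h. f x * g' x h + f' x h * g x"]) (auto intro!: derivative_intros trig_exp.intros)
next
  case (exp f)
  then obtain f' where f': "\<And>x. (f has_derivative f' x) (at x)"
    "\<And>i. trig_exp (\<lambda>x. f' x (axis i 1))" by blast
  have "((\<lambda>x. exp (f x)) has_derivative (\<lambda>h. exp (f x) * f' x h)) (at x)" for x
    by (auto intro!: derivative_eq_intros f')
  moreover have "trig_exp (\<lambda>x. exp (f x) * f' x (axis i 1))" for i
    by (intro trig_exp.intros f' exp.hyps)
  ultimately show ?case
    by (intro exI[of _ "\<lambda>x h. exp (f x) * f' x h"]) blast
qed

text \<open>
  The induction on \<open>k\<close> goes through for arbitrary \<open>f\<close> because the partial derivatives stay in the
  class.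
\<close>
lemma trig_exp_C_k:
  assumes "trig_exp f"
  shows "C_k k f"
  using assms
proof (induction k arbitrary: f)
  case 0
  from trig_exp_has_derivative[OF 0] have "f differentiable_on UNIV"
    by (auto simp: differentiable_on_def differentiable_def)
  then show ?case by (simp add: differentiable_imp_continuous_on)
next
  case (Suc k)
  obtain f' where f': "\<And>x. (f has_derivative f' x) (at x)"
    "\<And>i. trig_exp (\<lambda>x. f' x (axis i 1))" using trig_exp_has_derivative[OF Suc.prems] by blast
  have "pderiv i f = (\<lambda>x. f' x (axis i 1))" for i
    by (simp add: fun_eq_iff pderiv_def frechet_derivative_at[OF f'(1), symmetric])
  with f' Suc.IH show ?case
    by (auto simp: differentiable_on_def differentiable_def)
qed

text \<open>
  Both terms have the form \<open>cos (2 * pi / L * d)\<close>, for \<open>d\<close> the distance to the midpoint of the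
  interval from \<open>a\<close> to \<open>b\<close> and for \<open>d\<close> half its length, so the sign tells whether \<open>t\<close> is, modulo
  \<open>L\<close>, inside the interval.
\<close>
definition periodic_bump :: "real \<Rightarrow> real \<Rightarrow> real \<Rightarrow> real \<Rightarrow> real" where
  "periodic_bump L a b t = cos (2*pi/L * (t - (a + b)/2)) - cos (pi/L * (b - a))"

text \<open>
  The angle \<open>y\<close> at \<open>t\<close> and the angle \<open>h\<close> at the endpoints satisfy \<open>0 < h \<le> pi\<close> and
  \<open>0 \<le> y \<le> 2 * pi - h\<close>, since the interval and \<open>t\<close> lie in one period. On this range \<open>cos y\<close>
  exceeds \<open>cos h\<close> exactly if \<open>y < h\<close>: the cosine decreases up to \<open>pi\<close> and is symmetric about it.
\<close>
lemma periodic_bump_pos_iff: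
  assumes "0 \<le> a" "a < b" "b \<le> L" "0 \<le> t" "t < L"
  shows "0 < periodic_bump L a b t \<longleftrightarrow> a < t \<and> t < b"
proof -
  define y where "y = 2*pi/L * \<bar>t - (a + b)/2\<bar>"
  define h where "h = pi/L * (b - a)"
  have L: "0 < L" using assms by simp
  have s: "periodic_bump L a b t = cos y - cos h"
  proof (cases "t \<ge> (a+b)/2")
    case False
    then have "y = - (2*pi/L * (t - (a + b)/2))"
      unfolding y_def minus_mult_right by (intro arg_cong2[where f = "(*)"]) auto
    then have "cos y = cos (2*pi/L * (t - (a + b)/2))" by (metis cos_minus)
    then show ?thesis by (simp add: periodic_bump_def h_def)
  qed (simp add: periodic_bump_def y_def h_def)
  have scale: "u \<le> v \<Longrightarrow> pi/L * u \<le> pi/L * v" "u < v \<Longrightarrow> pi/L * u < pi/L * v" for u v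
    using L by (simp_all add: divide_strict_right_mono divide_right_mono)
  have y2: "y = pi/L * (2 * \<bar>t - (a + b)/2\<bar>)" by (simp add: y_def)
  have piL: "pi/L * L = pi" using L by simp
  have h0: "0 < h" "h \<le> pi" 
    using scale(2)[of 0 "b-a"] scale(1)[of "b-a" L] assms L piL by (auto simp: h_def)
  have y0: "0 \<le> y" using L by (simp add: y_def)
  have yh: "y < h \<longleftrightarrow> a < t \<and> t < b"
  proof -
    have "y < h \<longleftrightarrow> 2 * \<bar>t - (a + b)/2\<bar> < b - a"
      unfolding y2 h_def using L by (subst mult_less_cancel_left_pos) auto
    also have "\<dots> \<longleftrightarrow> a < t \<and> t < b" by (auto simp: abs_if field_simps)
    finally show ?thesis .
  qed
  have y_upper: "y \<le> 2*pi - h"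
  proof -
    have "2 * \<bar>t - (a + b)/2\<bar> \<le> 2*L - (b - a)" using assms by (auto simp: abs_if field_simps)
    from scale(1)[OF this] have "y \<le> pi/L * (2 * L - (b-a))" unfolding y2 .
    also have "\<dots> = 2 * (pi/L * L) - h" by (simp add: h_def right_diff_distrib)
    finally show ?thesis using piL by simp
  qed
  have "cos h < cos y \<longleftrightarrow> y < h"
  proof
    assume "y < h"
    then show "cos h < cos y" using y0 h0 by (intro cos_monotone_0_pi) auto
  next
    assume c: "cos h < cos y"
    show "y < h"
    proof (rule ccontr)
      assume n: "\<not> y < h"
      have "cos y \<le> cos h"
      proof (cases "y \<le> pi")
        case True
        then show ?thesis using n h0 by (intro cos_monotone_0_pi_le) auto
      next
        case False
        have "cos (2*pi - y) \<le> cos h" using False y_upper h0 by (intro cos_monotone_0_pi_le) auto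
        then show ?thesis by simp
      qed
      with c show False by simp
    qed
  qed
  then show ?thesis using s yh by simp
qed

text \<open>
  With \<open>s\<close> a bump value, \<open>n * exp (- n * s)\<close> tends to \<open>0\<close> for \<open>s > 0\<close> and to infinity for
  \<open>s \<le> 0\<close>. The prefactor \<open>n\<close> settles the boundary case \<open>s = 0\<close>, so the limit below is exactly the
  indicator of the open box, at every point of the cell.
\<close>
definition box_approx :: "real \<Rightarrow> real^3 \<Rightarrow> real^3 \<Rightarrow> nat \<Rightarrow> real^3 \<Rightarrow> real" where
  "box_approx L a b n x =
     exp (- real n * (\<Sum>i\<in>UNIV. exp (- real n * periodic_bump L (a $ i) (b $ i) (x $ i))))"

lemma box_approx_test_function:
  assumes "0 < L"
  shows "box_approx L a b n \<in> test_functions L"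
proof -
  have "trig_exp (\<lambda>x. cos (2*pi/L * x $ i + (- (2*pi/L * ((a $ i + b $ i)/2)))) + (- cos (pi/L * (b $ i - a $ i))))" for i
    by (intro trig_exp.intros trig_exp_cos)
  then have "trig_exp (\<lambda>x. periodic_bump L (a $ i) (b $ i) (x $ i))" for i
    by (simp add: periodic_bump_def right_diff_distrib)
  then have "trig_exp (box_approx L a b n)"
    unfolding box_approx_def[abs_def] by (intro trig_exp.intros trig_exp_sum) auto
  moreover have "periodic L (box_approx L a b n)"
  proof -
    have shift: "periodic_bump L c d (t + L) = periodic_bump L c d t" for c d t
    proof -
      have "2*pi/L * (t + L - (c + d)/2) = 2*pi/L * (t - (c + d)/2) + 2*pi"
        using assms by (simp add: field_simps)
      then show ?thesis by (simp add: periodic_bump_def)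
    qed
    have "periodic_bump L c d ((x + axis j L) $ i) = periodic_bump L c d (x $ i)" for c d i j and x :: "real^3"
      by (cases "i = j") (simp_all add: shift axis_def)
    then show ?thesis unfolding periodic_def box_approx_def by (simp only: simp_thms)
  qed
  ultimately show ?thesis by (simp add: test_functions_def trig_exp_C_k)
qed

lemma box_approx_bounded: "\<bar>box_approx L a b n x\<bar> \<le> 1"
  by (auto simp: box_approx_def intro!: mult_nonneg_nonneg sum_nonneg)

lemma box_approx_tendsto_indicator:
  assumes ab: "\<And>i. 0 \<le> a $ i" "\<And>i. a $ i < b $ i" "\<And>i. b $ i \<le> L" and x: "x \<in> cell L"
  shows "(\<lambda>n. box_approx L a b n x) \<longlonglongrightarrow> indicator (box a b) x"
proof -
  let ?s = "\<lambda>i. periodic_bump L (a $ i) (b $ i) (x $ i)"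
  have pos: "0 < ?s i \<longleftrightarrow> a $ i < x $ i \<and> x $ i < b $ i" for i
    using ab x by (intro periodic_bump_pos_iff) (auto simp: cell_def)
  show ?thesis
  proof (cases "x \<in> box a b")
    case True
    then have s: "0 < ?s i" for i by (simp add: pos mem_box_cart)
    have "(\<lambda>n. real n * exp (- real n * ?s i)) \<longlonglongrightarrow> 0" for i
      using s[of i] by real_asymp
    then have "(\<lambda>n. exp (- (\<Sum>i\<in>UNIV. real n * exp (- real n * ?s i)))) \<longlonglongrightarrow> exp (- (\<Sum>i\<in>(UNIV::3 set). 0))"
      by (intro tendsto_intros)
    then show ?thesis using True by (simp add: box_approx_def sum_distrib_left sum_negf)
  next
    case False
    then have "\<exists>i. \<not> 0 < ?s i" by (simp add: pos mem_box_cart)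
    then obtain i where i: "?s i \<le> 0" by (auto simp: not_less)
    have "box_approx L a b n x \<le> exp (- real n)" for n
    proof -
      have "1 \<le> exp (- real n * ?s i)" using i by (simp add: mult_nonneg_nonpos)
      also have "\<dots> \<le> (\<Sum>i\<in>UNIV. exp (- real n * ?s i))"
        by (rule member_le_sum) auto
      finally have "real n * 1 \<le> real n * (\<Sum>i\<in>UNIV. exp (- real n * ?s i))"
        by (rule mult_left_mono) simp
      then show ?thesis by (simp add: box_approx_def)
    qed
    moreover have "(\<lambda>n. exp (- real n)) \<longlonglongrightarrow> 0" by real_asymp
    ultimately have "(\<lambda>n. box_approx L a b n x) \<longlonglongrightarrow> 0"
      by (intro Lim_null_comparison[of "\<lambda>n. box_approx L a b n x" "\<lambda>n. exp (- real n)"])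
         (simp_all add: box_approx_def)
    then show ?thesis using False by simp
  qed
qed

section \<open>The fundamental lemma of the calculus of variations\<close>

lemma test_function_continuous:
  assumes "f \<in> test_functions L"
  shows "continuous_on UNIV f"
  using assms differentiable_imp_continuous_on[of f UNIV]
  by (force simp: test_functions_def dest: spec[of _ "Suc 0"])

lemma test_function_pderiv_continuous:
  assumes "f \<in> test_functions L"
  shows "continuous_on UNIV (pderiv i f)"
  using assms by (force simp: test_functions_def dest: spec[of _ "Suc 0"])

text \<open>
  Up to the null set where a coordinate vanishes, a box meets the cell in a box whose corners are
  clamped to \<open>[0, L]\<close>. For such boxes the bounded approximations by test functions and dominated
  convergence apply.
\<close>
lemma fundamental_lemma_box:
  assumes L: "0 < L" and g: "integrable (torus L) g"
    and orth: "\<And>f. f \<in> test_functions L \<Longrightarrow> (LINT x|torus L. g x * f x) = 0"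
  shows "(LINT x|torus L. indicator (box a b) x * g x) = 0"
proof -
  define a' :: "real^3" where "a' = (\<chi> i. max (a $ i) 0)"
  define b' :: "real^3" where "b' = (\<chi> i. min (b $ i) L)"
  have "AE x in torus L. \<forall>i. x $ i \<noteq> 0"
  proof (rule AE_all_countable[THEN iffD2, rule_format])
    fix i :: 3
    have "negligible {x::real^3. x $ i = 0}" by (rule negligible_standard_hyperplane_cart)
    then have "AE x in lebesgue. x \<notin> {x::real^3. x $ i = 0}"
      by (intro AE_not_in) (simp add: negligible_iff_null_sets)
    then show "AE x in torus L. x $ i \<noteq> 0"
      unfolding AE_torus_iff by eventually_elim auto
  qed
  moreover have "AE x in torus L. x \<in> cell L" by (intro AE_I2) (simp add: space_torus)
  ultimately have ae: "AE x in torus L. indicator (box a b) x * g x = indicator (box a' b') x * g x"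
  proof eventually_elim
    case (elim x)
    then have "0 < x $ i" "x $ i < L" for i by (auto simp: cell_def less_le)
    then have "x \<in> box a b \<longleftrightarrow> x \<in> box a' b'" by (simp add: mem_box_cart a'_def b'_def)
    then show ?case by (simp add: indicator_def)
  qed
  have meas: "(\<lambda>x. indicator (box c d) x * g x) \<in> borel_measurable (torus L)" for c d :: "real^3"
    using borel_measurable_integrable[OF g] borel_imp_torus_measurable[of "indicator (box c d)"]
    by (intro borel_measurable_times) auto
  have "(LINT x|torus L. indicator (box a b) x * g x) = (LINT x|torus L. indicator (box a' b') x * g x)"
    by (intro integral_cong_AE ae meas)
  also have "\<dots> = 0"
  proof (cases "\<forall>i. a' $ i < b' $ i")
    case False
    then have "box a' b' = {}" by (simp add: interval_eq_empty_cart not_less)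
    then show ?thesis by simp
  next
    case True
    have "(\<lambda>n. LINT x|torus L. box_approx L a' b' n x * g x) \<longlonglongrightarrow>
        (LINT x|torus L. indicator (box a' b') x * g x)"
    proof (rule integral_dominated_convergence)
      show "integrable (torus L) (\<lambda>x. \<bar>g x\<bar>)" using g by simp
      show "(\<lambda>x. indicator (box a' b') x * g x) \<in> borel_measurable (torus L)" by (rule meas)
      show "(\<lambda>x. box_approx L a' b' n x * g x) \<in> borel_measurable (torus L)" for n
        using borel_imp_torus_measurable[OF borel_measurable_continuous_onI[OF
              test_function_continuous[OF box_approx_test_function[OF L]]]]
        by (intro borel_measurable_times borel_measurable_integrable[OF g])
      show "AE x in torus L. (\<lambda>n. box_approx L a' b' n x * g x) \<longlonglongrightarrow> indicator (box a' b') x * g x"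
        using True
        by (intro AE_I2 tendsto_intros box_approx_tendsto_indicator)
           (auto simp: space_torus a'_def b'_def)
      show "AE x in torus L. norm (box_approx L a' b' n x * g x) \<le> \<bar>g x\<bar>" for n
        using box_approx_bounded by (intro AE_I2) (simp add: abs_mult mult_left_le_one_le)
    qed
    moreover have "(LINT x|torus L. box_approx L a' b' n x * g x) = 0" for n
      using orth[OF box_approx_test_function[OF L]] by (simp add: mult.commute)
    ultimately show ?thesis by (simp add: LIMSEQ_const_iff)
  qed
  finally show ?thesis .
qed

text \<open>
  Open boxes are an intersection-stable generator of the Borel sets, and the sets over which \<open>g\<close> has
  integral zero form a Dynkin system. Complements use that the constant \<open>1\<close> is a test function.
\<close>
lemma fundamental_lemma_borel:
  assumes L: "0 < L" and g: "integrable (torus L) g"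
    and orth: "\<And>f. f \<in> test_functions L \<Longrightarrow> (LINT x|torus L. g x * f x) = 0"
    and A: "A \<in> sets borel"
  shows "(LINT x|torus L. indicator A x * g x) = 0"
proof -
  have int: "integrable (torus L) (\<lambda>x. indicator B x * g x)" if "B \<in> sets borel" for B
  proof (rule Bochner_Integration.integrable_bound[OF g])
    show "(\<lambda>x. indicator B x * g x) \<in> borel_measurable (torus L)"
      using that borel_measurable_integrable[OF g] borel_imp_torus_measurable[of "indicator B"]
      by (intro borel_measurable_times) auto
  qed (auto simp: indicator_def)
  let ?G = "range (\<lambda>(a, b). box a b :: (real^3) set)"
  have borel: "sets borel = sigma_sets UNIV ?G"
    by (subst borel_eq_box) (simp add: sets_measure_of)
  have "Int_stable ?G"
    by (rule Int_stableI) (auto simp: box_Int_box intro: range_eqI[of _ _ "(_, _)"])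
  moreover have "?G \<subseteq> Pow UNIV" by simp
  moreover have "A \<in> sigma_sets UNIV ?G" using A borel by simp
  ultimately show ?thesis
  proof (induction rule: sigma_sets_induct_disjoint)
    case (basic A)
    then show ?case using fundamental_lemma_box[OF L g orth] by auto
  next
    case empty
    show ?case by simp
  next
    case (compl A)
    have "(\<lambda>x. 1) \<in> test_functions L"
      using trig_exp_C_k[OF trig_exp.const[of 1]] by (simp add: test_functions_def periodic_def)
    from orth[OF this] have "(LINT x|torus L. g x) = 0" by simp
    moreover have "(LINT x|torus L. indicator (UNIV - A) x * g x)
        = (LINT x|torus L. g x - indicator A x * g x)"
      by (intro Bochner_Integration.integral_cong) (auto simp: indicator_def)
    ultimately show ?case
      using compl int[of A] g borel by simp
  next
    case (union A)
    then have A: "A i \<in> sets borel" for i using borel by blast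
    have sum: "(\<Sum>i<n. indicator (A i) x) = (indicator (\<Union>i<n. A i) x :: real)" for n x
      using union(1) by (subst indicator_UN_disjoint) (auto simp: disjoint_family_on_def)
    \<comment> \<open>By disjointness the partial sums are indicators, so \<open>\<bar>g\<bar>\<close> dominates.\<close>
    have "(\<lambda>n. LINT x|torus L. (\<Sum>i<n. indicator (A i) x * g x)) \<longlonglongrightarrow>
        (LINT x|torus L. indicator (\<Union>i. A i) x * g x)"
    proof (rule integral_dominated_convergence)
      show "integrable (torus L) (\<lambda>x. \<bar>g x\<bar>)" using g by simp
      show "(\<lambda>x. indicator (\<Union>i. A i) x * g x) \<in> borel_measurable (torus L)"
        using int[of "\<Union>i. A i"] A by auto
      show "(\<lambda>x. \<Sum>i<n. indicator (A i) x * g x) \<in> borel_measurable (torus L)" for n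
        by (intro borel_measurable_sum borel_measurable_integrable int A)
      have "(\<lambda>n. (\<Sum>i<n. indicator (A i) x) * g x) \<longlonglongrightarrow> indicator (\<Union>i. A i) x * g x" for x
      proof (rule tendsto_mult[OF _ tendsto_const])
        have "(\<lambda>i. indicator (A i) x :: real) sums indicator (\<Union>i. A i) x"
          using union(1) by (intro indicator_sums) (auto simp: disjoint_family_on_def)
        then show "(\<lambda>n. \<Sum>i<n. indicator (A i) x :: real) \<longlonglongrightarrow> indicator (\<Union>i. A i) x"
          by (simp add: sums_def)
      qed
      then show "AE x in torus L. (\<lambda>n. \<Sum>i<n. indicator (A i) x * g x) \<longlonglongrightarrow> indicator (\<Union>i. A i) x * g x"
        by (intro AE_I2) (simp add: sum_distrib_right)
      show "AE x in torus L. norm (\<Sum>i<n. indicator (A i) x * g x) \<le> \<bar>g x\<bar>" for n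
        unfolding sum_distrib_right[symmetric] sum by (intro AE_I2) (simp add: indicator_def)
    qed
    moreover have "(LINT x|torus L. (\<Sum>i<n. indicator (A i) x * g x)) = 0" for n
      using union(3) int[OF A] by (subst Bochner_Integration.integral_sum) auto
    ultimately show ?case by (simp add: LIMSEQ_const_iff)
  qed
qed

text \<open>
  Lebesgue-measurable sets differ from Borel sets by null sets, and a function whose integral
  vanishes over every measurable set is zero almost everywhere.
\<close>
lemma fundamental_lemma:
  assumes L: "0 < L" and g: "integrable (torus L) g"
    and orth: "\<And>f. f \<in> test_functions L \<Longrightarrow> (LINT x|torus L. g x * f x) = 0"
  shows "AE x in torus L. g x = 0"
proof -
  interpret finite_measure "torus L" by (rule finite_measure_torus)
  show ?thesis
  proof (rule density_zero[OF g])
    fix A assume A: "A \<in> sets (torus L)"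
    then have "A \<in> sets lebesgue"
      using cell_lebesgue by (auto simp: torus_eq sets_restrict_space_iff)
    then obtain S N N' where SN: "A = S \<union> N" "N \<subseteq> N'" "N' \<in> null_sets lborel" "S \<in> sets lborel"
      by (rule sets_completionE)
    have "AE x in lebesgue. x \<notin> N'" using SN(3) by (intro AE_completion AE_not_in)
    then have "AE x in torus L. x \<notin> N'"
      unfolding AE_torus_iff by eventually_elim simp
    then have "AE x in torus L. indicator A x *\<^sub>R g x = indicator S x * g x"
      by eventually_elim (use SN in \<open>auto simp: indicator_def\<close>)
    then have "set_lebesgue_integral (torus L) A g = (LINT x|torus L. indicator S x * g x)"
      unfolding set_lebesgue_integral_def
    proof (rule integral_cong_AE[rotated 2])
      show "(\<lambda>x. indicator A x *\<^sub>R g x) \<in> borel_measurable (torus L)"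
        using borel_measurable_integrable[OF g] A by simp
      show "(\<lambda>x. indicator S x * g x) \<in> borel_measurable (torus L)"
        by (rule borel_measurable_times[OF borel_imp_torus_measurable borel_measurable_integrable[OF g]])
           (use SN(4) in simp)
    qed
    also have "\<dots> = 0" using SN(4) by (intro fundamental_lemma_borel[OF L g orth]) auto
    finally show "set_lebesgue_integral (torus L) A g = 0" .
  qed
qed

section \<open>Weak gradients and the space \<open>H1\<close>\<close>

lemma has_weak_gradient_square_integrable:
  "has_weak_gradient L u g \<Longrightarrow> square_integrable (torus L) (\<lambda>x. g x $ i)"
  by (simp add: has_weak_gradient_def L2_def square_integrable_def)

lemma has_weak_gradient_unique:
  assumes L: "0 < L" and g: "has_weak_gradient L u g" and h: "has_weak_gradient L u h"
  shows "AE x in torus L. g x = h x"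
proof -
  have "AE x in torus L. \<forall>i. g x $ i - h x $ i = 0"
  proof (rule AE_all_countable[THEN iffD2, rule_format])
    fix i :: 3
    note sq = has_weak_gradient_square_integrable[OF g, of i] has_weak_gradient_square_integrable[OF h, of i]
    show "AE x in torus L. g x $ i - h x $ i = 0"
    proof (rule fundamental_lemma[OF L])
      show "integrable (torus L) (\<lambda>x. g x $ i - h x $ i)"
        using sq[THEN square_integrable_torus_imp_integrable] by simp
      fix f assume f: "f \<in> test_functions L"
      then have "square_integrable (torus L) f"
        by (intro continuous_imp_square_integrable test_function_continuous)
      note int = sq[THEN square_integrable_mult_integrable, OF this]
      have "- (LINT x|torus L. g x $ i * f x) = (LINT x|torus L. u x * pderiv i f x)"
        using g f by (simp add: has_weak_gradient_def)
      also have "\<dots> = - (LINT x|torus L. h x $ i * f x)"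
        using h f by (simp add: has_weak_gradient_def)
      finally show "(LINT x|torus L. (g x $ i - h x $ i) * f x) = 0"
        using int by (simp add: left_diff_distrib)
    qed
  qed
  then show ?thesis by eventually_elim (simp add: vec_eq_iff)
qed

lemma L2_square_integrable: "u \<in> L2 L \<longleftrightarrow> periodic L u \<and> square_integrable (torus L) u"
  by (simp add: L2_def square_integrable_def)

lemma L2_add_scale:
  assumes "u \<in> L2 L" "v \<in> L2 L"
  shows "(\<lambda>x. u x + c * v x) \<in> L2 L"
  using assms by (auto simp: L2_square_integrable periodic_def intro: square_integrable_add square_integrable_scale)

lemma has_weak_gradient_add_scale:
  assumes u: "u \<in> L2 L" "has_weak_gradient L u g" and v: "v \<in> L2 L" "has_weak_gradient L v h"
  shows "has_weak_gradient L (\<lambda>x. u x + c * v x) (\<lambda>x. g x + c *\<^sub>R h x)"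
  unfolding has_weak_gradient_def
proof (intro conjI allI ballI)
  fix i
  show "(\<lambda>x. (g x + c *\<^sub>R h x) $ i) \<in> L2 L"
    using u v L2_add_scale by (simp add: has_weak_gradient_def)
  fix f assume f: "f \<in> test_functions L"
  have sq: "square_integrable (torus L) f" "square_integrable (torus L) (pderiv i f)"
    "square_integrable (torus L) u" "square_integrable (torus L) v"
    "square_integrable (torus L) (\<lambda>x. g x $ i)" "square_integrable (torus L) (\<lambda>x. h x $ i)"
    using f u v by (auto intro: continuous_imp_square_integrable test_function_continuous
        test_function_pderiv_continuous has_weak_gradient_square_integrable simp: L2_square_integrable)
  note int = sq[THEN square_integrable_mult_integrable]
  have "(LINT x|torus L. (u x + c * v x) * pderiv i f x)
      = (LINT x|torus L. u x * pderiv i f x) + c * (LINT x|torus L. v x * pderiv i f x)"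
    using int(3,4)[OF sq(2)] by (simp add: distrib_right mult.assoc)
  also have "\<dots> = - ((LINT x|torus L. g x $ i * f x) + c * (LINT x|torus L. h x $ i * f x))"
    using u(2) v(2) f by (simp add: has_weak_gradient_def)
  also have "\<dots> = - (LINT x|torus L. (g x + c *\<^sub>R h x) $ i * f x)"
    using int(5,6)[OF sq(1)] by (simp add: distrib_right mult.assoc)
  finally show "(LINT x|torus L. (u x + c * v x) * pderiv i f x)
      = - (LINT x|torus L. (g x + c *\<^sub>R h x) $ i * f x)" .
qed

lemma has_weak_gradient_weak_gradient:
  "u \<in> H1 L \<Longrightarrow> has_weak_gradient L u (weak_gradient L u)"
  unfolding weak_gradient_def by (rule someI_ex[of "has_weak_gradient L u"]) (auto simp: H1_def)

lemma H1_add_scale: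
  assumes "u \<in> H1 L" "v \<in> H1 L"
  shows "(\<lambda>x. u x + c * v x) \<in> H1 L"
proof -
  have "integrable (torus L) u" "integrable (torus L) v"
    using assms by (auto simp: H1_def L2_square_integrable intro: square_integrable_torus_imp_integrable)
  then show ?thesis
    using assms has_weak_gradient_add_scale[of u L _ v _ c] L2_add_scale[of u L v c]
    by (auto simp: H1_def)
qed

text \<open>
  The chosen gradient of a linear combination and the linear combination of the chosen gradients are
  two weak gradients of one function; uniqueness makes them agree.
\<close>
lemma weak_gradient_add_scale:
  assumes "0 < L" "u \<in> H1 L" "v \<in> H1 L"
  shows "AE x in torus L. weak_gradient L (\<lambda>x. u x + c * v x) x
           = weak_gradient L u x + c *\<^sub>R weak_gradient L v x"
  using assms
  by (intro has_weak_gradient_unique[OF assms(1) has_weak_gradient_weak_gradient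
        has_weak_gradient_add_scale] H1_add_scale has_weak_gradient_weak_gradient)
     (auto simp: H1_def)

section \<open>Convexity and first-order expansion of the energy\<close>

lemma min_square_expansion:
  fixes s h :: real
  defines "R \<equiv> (min (s + h) 0)\<^sup>2 - (min s 0)\<^sup>2 - 2 * min s 0 * h"
  shows "0 \<le> R" "R \<le> h\<^sup>2"
proof -
  consider "s \<le> 0" "s + h \<le> 0" | "s \<le> 0" "0 < s + h" | "0 < s" "s + h \<le> 0" | "0 < s" "0 < s + h"
    by linarith
  then have "0 \<le> R \<and> R \<le> h\<^sup>2"
  proof cases
    case 1
    then show ?thesis by (simp add: R_def power2_sum)
  next
    case 2
    then have R: "R = - s * (s + 2 * h)" by (simp add: R_def min_def power2_eq_square algebra_simps)
    have "h\<^sup>2 - R = (s + h)\<^sup>2" unfolding R by (simp add: power2_eq_square algebra_simps)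
    moreover have "0 \<le> R" unfolding R using 2 by (intro mult_nonneg_nonneg) auto
    ultimately show ?thesis by (metis diff_ge_0_iff_ge zero_le_power2)
  next
    case 3
    then have R: "R = (s + h)\<^sup>2" by (simp add: R_def)
    have "(s + h)\<^sup>2 \<le> h\<^sup>2" using 3 by (simp add: abs_le_square_iff[symmetric])
    then show ?thesis unfolding R by simp
  next
    case 4
    then show ?thesis by (simp add: R_def)
  qed
  then show "0 \<le> R" "R \<le> h\<^sup>2" by auto
qed

definition energy_density :: "real \<Rightarrow> real^3 \<Rightarrow> real" where
  "energy_density m v = 1/2 * (norm v)\<^sup>2 - 1/4 * (min (m - v $ 3) 0)\<^sup>2"

text \<open>The derivative of \<open>energy_density m\<close> at \<open>v\<close> in direction \<open>w\<close>.\<close>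

definition energy_flux :: "real \<Rightarrow> real^3 \<Rightarrow> real^3 \<Rightarrow> real" where
  "energy_flux m v w = v \<bullet> w + 1/2 * min (m - v $ 3) 0 * w $ 3"

text \<open>
  The remainder of \<open>|v|\<^sup>2/2\<close> is exactly \<open>t\<^sup>2 |w|\<^sup>2/2\<close>, and the subtracted term contributes a
  remainder between \<open>0\<close> and \<open>t\<^sup>2 (w $ 3)\<^sup>2/4\<close>, which is at most half of that.
\<close>
lemma energy_density_expansion:
  fixes v w :: "real^3" and m t :: real
  defines "R \<equiv> energy_density m (v + t *\<^sub>R w) - energy_density m v - t * energy_flux m v w"
  shows "0 \<le> R" "R \<le> t\<^sup>2 / 2 * (norm w)\<^sup>2"
proof -
  define Q where "Q = (min (m - v $ 3 + - (t * w $ 3)) 0)\<^sup>2 - (min (m - v $ 3) 0)\<^sup>2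
      - 2 * min (m - v $ 3) 0 * - (t * w $ 3)"
  have Q: "0 \<le> Q" "Q \<le> t\<^sup>2 * (w $ 3)\<^sup>2"
    using min_square_expansion[of "m - v $ 3" "- (t * w $ 3)"]
    by (simp_all add: Q_def power_mult_distrib)
  have R: "R = t\<^sup>2 / 2 * (norm w)\<^sup>2 - 1/4 * Q"
    unfolding R_def Q_def energy_density_def energy_flux_def power2_norm_eq_inner
    by (simp add: inner_add_left inner_add_right inner_commute power2_eq_square algebra_simps)
  have "(w $ 3)\<^sup>2 \<le> (norm w)\<^sup>2"
    using component_le_norm_cart[of w 3] by (simp add: abs_le_square_iff[symmetric])
  then have "t\<^sup>2 * (w $ 3)\<^sup>2 \<le> t\<^sup>2 * (norm w)\<^sup>2" by (rule mult_left_mono) simp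
  then show "0 \<le> R" "R \<le> t\<^sup>2 / 2 * (norm w)\<^sup>2"
    using Q zero_le_mult_iff[of "t\<^sup>2" "(norm w)\<^sup>2"] unfolding R by (auto simp: field_simps)
qed

lemma inner_integrable:
  fixes g h :: "'a \<Rightarrow> real^'n"
  assumes "\<And>i. square_integrable N (\<lambda>x. g x $ i)" "\<And>i. square_integrable N (\<lambda>x. h x $ i)"
  shows "integrable N (\<lambda>x. g x \<bullet> h x)"
  unfolding inner_vec_def inner_real_def
  using assms by (intro Bochner_Integration.integrable_sum square_integrable_mult_integrable)

lemma square_integrable_truncation:
  assumes "M \<in> L2 L" "square_integrable (torus L) u"
  shows "square_integrable (torus L) (\<lambda>x. min (M x - u x) 0)"
  using assms by (intro square_integrable_min_0 square_integrable_diff) (auto simp: L2_square_integrable)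

lemma energy_density_integrable:
  assumes "M \<in> L2 L" and g: "\<And>i. square_integrable (torus L) (\<lambda>x. g x $ i)"
  shows "integrable (torus L) (\<lambda>x. energy_density (M x) (g x))"
  unfolding energy_density_def power2_norm_eq_inner
  using square_integrable_truncation[OF assms] inner_integrable[OF g g]
  by (simp add: square_integrable_def)

lemma energy_flux_integrable:
  assumes "M \<in> L2 L" and g: "\<And>i. square_integrable (torus L) (\<lambda>x. g x $ i)"
    and h: "\<And>i. square_integrable (torus L) (\<lambda>x. h x $ i)"
  shows "integrable (torus L) (\<lambda>x. energy_flux (M x) (g x) (h x))"
  unfolding energy_flux_def mult.assoc
  using square_integrable_mult_integrable[OF square_integrable_truncation[OF assms(1) g] h]
    inner_integrable[OF g h] by simp

text \<open>
  The pointwise expansion, integrated along the line through \<open>u\<close> in direction \<open>v\<close>. The functional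
  \<open>PV\<close> is linear and contributes only to the first-order coefficient \<open>A\<close>.
\<close>
lemma energy_expansion:
  assumes L: "0 < L" and M: "M \<in> L2 L" and PV: "PV \<in> H_minus1 L" and u: "u \<in> H1 L" and v: "v \<in> H1 L"
  defines "A \<equiv> (LINT x|torus L. energy_flux (M x) (weak_gradient L u x) (weak_gradient L v x)) + PV v"
    and "K \<equiv> LINT x|torus L. (norm (weak_gradient L v x))\<^sup>2"
  defines "R \<equiv> \<lambda>t. energy L M PV (\<lambda>x. u x + t * v x) - energy L M PV u - t * A"
  shows "0 \<le> R t" "R t \<le> t\<^sup>2 / 2 * K"
proof -
  let ?g = "weak_gradient L u" and ?h = "weak_gradient L v"
  let ?k = "weak_gradient L (\<lambda>x. u x + t * v x)"
  have uv: "(\<lambda>x. u x + t * v x) \<in> H1 L" using u v by (rule H1_add_scale)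
  note sq = has_weak_gradient_square_integrable[OF has_weak_gradient_weak_gradient]
  note int = energy_density_integrable[OF M sq[OF u]] energy_flux_integrable[OF M sq[OF u] sq[OF v]]
    inner_integrable[OF sq[OF v] sq[OF v], folded power2_norm_eq_inner]
    energy_density_integrable[OF M sq[OF uv]]
  have PV_add: "PV (\<lambda>x. u x + t * v x) = PV u + t * PV v"
  proof -
    have "(\<lambda>x. t * v x) \<in> H1 L"
      \<comment> \<open>written as \<open>v + (t - 1) v\<close>\<close>
      using H1_add_scale[OF v v, of "t - 1"] by (simp add: algebra_simps)
    then show ?thesis using PV u v unfolding H_minus1_def by auto
  qed
  let ?r = "\<lambda>x. energy_density (M x) (?k x) - energy_density (M x) (?g x) - t * energy_flux (M x) (?g x) (?h x)"
  have r: "R t = (LINT x|torus L. ?r x)"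
    unfolding R_def A_def energy_def energy_density_def[symmetric] PV_add
    using int by (simp add: algebra_simps)
  have rint: "integrable (torus L) ?r" using int by simp
  have ae: "AE x in torus L. 0 \<le> ?r x \<and> ?r x \<le> t\<^sup>2 / 2 * (norm (?h x))\<^sup>2"
    using weak_gradient_add_scale[OF L u v, of t]
    by eventually_elim (use energy_density_expansion in simp)
  show "0 \<le> R t" unfolding r using ae by (intro integral_nonneg_AE) auto
  have "R t \<le> (LINT x|torus L. t\<^sup>2 / 2 * (norm (?h x))\<^sup>2)"
    unfolding r using ae int rint by (intro integral_mono_AE) auto
  then show "R t \<le> t\<^sup>2 / 2 * K" by (simp add: K_def)
qed

lemma linear_coefficient_zero:
  fixes a k :: real
  assumes nonneg: "\<And>t. 0 \<le> t * a + t\<^sup>2 * k"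
  shows "a = 0"
proof -
  define c where "c = 1 + \<bar>k\<bar>"
  have c: "0 < c" "k - c \<le> -1" by (auto simp: c_def)
  \<comment> \<open>the hypothesis at \<open>t = - a / c\<close>, with the denominators cleared\<close>
  have "0 \<le> c\<^sup>2 * ((- a / c) * a + (- a / c)\<^sup>2 * k)"
    by (intro mult_nonneg_nonneg nonneg) simp
  also have "\<dots> = a\<^sup>2 * (k - c)" using c(1) by (simp add: field_simps power2_eq_square)
  also have "\<dots> \<le> a\<^sup>2 * (-1)" using c(2) by (rule mult_left_mono) simp
  finally show ?thesis by simp
qed

theorem lemma4p9:
  fixes L :: real
    and M :: "real^3 \<Rightarrow> real"
    and PV :: "(real^3 \<Rightarrow> real) \<Rightarrow> real"
    and p :: "real^3 \<Rightarrow> real"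
  assumes "0 < L"
    and "M \<in> L2 L"
    and "PV \<in> H_minus1 L"
    and "p \<in> H1 L"
  shows "(\<forall>q \<in> H1 L. energy L M PV p \<le> energy L M PV q) \<longleftrightarrow>
         (\<forall>\<phi> \<in> H1 L.
            (LINT x|torus L. weak_gradient L p x \<bullet> weak_gradient L \<phi> x
               + 1/2 * min (M x - weak_gradient L p x $ 3) 0 * weak_gradient L \<phi> x $ 3)
            = - PV \<phi>)"
    (is "_ \<longleftrightarrow> (\<forall>\<phi> \<in> H1 L. ?I \<phi> = - PV \<phi>)")
proof -
  have I: "?I \<phi> = (LINT x|torus L. energy_flux (M x) (weak_gradient L p x) (weak_gradient L \<phi> x))" for \<phi>
    by (simp add: energy_flux_def)
  note expand = energy_expansion[OF assms, folded I]
  show ?thesis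
  proof (intro iffI ballI)
    fix \<phi> assume min: "\<forall>q \<in> H1 L. energy L M PV p \<le> energy L M PV q" and \<phi>: "\<phi> \<in> H1 L"
    have "?I \<phi> + PV \<phi> = 0"
    proof (rule linear_coefficient_zero)
      fix t
      show "0 \<le> t * (?I \<phi> + PV \<phi>) + t\<^sup>2 * ((LINT x|torus L. (norm (weak_gradient L \<phi> x))\<^sup>2) / 2)"
        using expand(2)[OF \<phi>, of t] bspec[OF min H1_add_scale[OF assms(4) \<phi>, of t]] by simp
    qed
    then show "?I \<phi> = - PV \<phi>" by simp
  next
    fix q assume weak: "\<forall>\<phi> \<in> H1 L. ?I \<phi> = - PV \<phi>" and q: "q \<in> H1 L"
    have d: "(\<lambda>x. q x + (-1) * p x) \<in> H1 L" using q assms(4) by (rule H1_add_scale)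
    show "energy L M PV p \<le> energy L M PV q"
      using expand(1)[OF d, of 1] bspec[OF weak d] by simp
  qed
qed

end
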